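(* Let $K(z,w)=\sum_{n=0}^\infty b_n(z\bar w)^n$, $b_n>0$, be a positive definite kernel on $\mathbb D\times\mathbb D$. If the multiplication operator $M_z$ on $(\mathcal H,K)$ is Möbius bounded, then (i) $\sum_{n=0}^\infty b_n=\infty$, and (ii) the sequence $\{nb_n\}_{n\geq 0}$ is unbounded.
   Context: $\mathbb D$ is the open unit disc; Möb is the group of all biholomorphic automorphisms of $\mathbb D$. A bounded operator $T$ is Möbius bounded if $\sigma(T)\subseteq\overline{\mathbb D}$ and $\sup_{\varphi\in\text{Möb}}\|\varphi(T)\|<\infty$, where $\varphi(T)$ is defined by the holomorphic functional calculus. $(\mathcal H,K)$ is the reproducing kernel Hilbert space of holomorphic functions on $\mathbb D$ with kernel $K$ (so the monomials are orthogonal with $\|z^n\|^2=1/b_n$), and $M_z$ is multiplication by the coordinate function $z$. *)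

theory Defs
  imports "HOL-Complex_Analysis.Complex_Analysis"
begin

section \<open>Complex Hilbert spaces\<close>

class scaleC =
  fixes scaleC :: "complex \<Rightarrow> 'a \<Rightarrow> 'a"  (infixr "*\<^sub>C" 75)

class complex_normed_vector = real_normed_vector + scaleC +
  assumes scaleC_add_right: "a *\<^sub>C (x + y) = a *\<^sub>C x + a *\<^sub>C y"
    and scaleC_add_left: "(a + b) *\<^sub>C x = a *\<^sub>C x + b *\<^sub>C x"
    and scaleC_scaleC: "a *\<^sub>C b *\<^sub>C x = (a * b) *\<^sub>C x"
    and scaleC_of_real: "complex_of_real r *\<^sub>C x = r *\<^sub>R x"
    and norm_scaleC: "norm (a *\<^sub>C x) = norm a * norm x"

text \<open>The inner product is linear in its first argument.\<close>

class complex_inner = complex_normed_vector +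
  fixes cinner :: "'a \<Rightarrow> 'a \<Rightarrow> complex"
  assumes cinner_commute: "cinner x y = cnj (cinner y x)"
    and cinner_add_left: "cinner (x + y) z = cinner x z + cinner y z"
    and cinner_scaleC_left: "cinner (a *\<^sub>C x) y = a * cinner x y"
    and norm_eq_sqrt_cinner: "norm x = sqrt (Re (cinner x x))"

class complex_hilbert = complex_inner + complete_space

instance complex_hilbert \<subseteq> banach ..

lemma bounded_linear_scaleC: "bounded_linear (\<lambda>x. c *\<^sub>C (x :: 'a :: complex_normed_vector))"
proof (rule bounded_linear_intro[where K = "norm c"])
  fix r :: real and x :: 'a
  show "c *\<^sub>C r *\<^sub>R x = r *\<^sub>R c *\<^sub>C x"
    by (simp only: scaleC_of_real[symmetric] scaleC_scaleC mult.commute)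
qed (simp_all add: scaleC_add_right norm_scaleC mult.commute)

instantiation blinfun :: (real_normed_vector, complex_normed_vector) complex_normed_vector
begin

lift_definition scaleC_blinfun ::
    "complex \<Rightarrow> ('a \<Rightarrow>\<^sub>L 'b) \<Rightarrow> ('a \<Rightarrow>\<^sub>L 'b)" is "\<lambda>c f x. c *\<^sub>C f x"
  by (rule bounded_linear_compose[OF bounded_linear_scaleC])

instance
proof
  fix a :: complex and f :: "'a \<Rightarrow>\<^sub>L 'b"
  have *: "norm (c *\<^sub>C g) \<le> norm c * norm g" for c and g :: "'a \<Rightarrow>\<^sub>L 'b"
  proof (rule norm_blinfun_bound)
    fix x
    have "norm c * norm (blinfun_apply g x) \<le> norm c * (norm g * norm x)"
      by (intro mult_left_mono norm_blinfun) simp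
    then show "norm (blinfun_apply (c *\<^sub>C g) x) \<le> norm c * norm g * norm x"
      by (simp add: scaleC_blinfun.rep_eq norm_scaleC mult.assoc)
  qed simp
  show "norm (a *\<^sub>C f) = norm a * norm f"
  proof (cases "a = 0")
    case True
    with *[of a f] show ?thesis by simp
  next
    case False
    have one: "1 *\<^sub>C x = x" for x :: 'b
      using scaleC_of_real[of 1 x] by simp
    have "f = inverse a *\<^sub>C a *\<^sub>C f"
      using False by (intro blinfun_eqI) (simp add: scaleC_blinfun.rep_eq scaleC_scaleC one)
    then have "norm f \<le> inverse (norm a) * norm (a *\<^sub>C f)"
      using *[of "inverse a" "a *\<^sub>C f"] by (simp add: norm_inverse)
    with False have "norm a * norm f \<le> norm (a *\<^sub>C f)"
      by (simp add: field_simps)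
    with *[of a f] show ?thesis by simp
  qed
qed (transfer; simp add: scaleC_add_right scaleC_add_left scaleC_scaleC scaleC_of_real)+

end


section \<open>Spectrum and holomorphic functional calculus\<close>

text \<open>
  The elements of \<open>'h \<Rightarrow>\<^sub>L 'h\<close> are only real-linear, so complex linearity is stated
  separately. The two-sided inverse of a complex-linear operator is complex-linear, so
  inverses may be taken in \<open>'h \<Rightarrow>\<^sub>L 'h\<close>.
\<close>

definition complex_linear :: "('h::complex_normed_vector \<Rightarrow>\<^sub>L 'h) \<Rightarrow> bool" where
  "complex_linear T \<longleftrightarrow> (\<forall>c x. blinfun_apply T (c *\<^sub>C x) = c *\<^sub>C blinfun_apply T x)"

definition inverse_operators ::
    "('h::complex_normed_vector \<Rightarrow>\<^sub>L 'h) \<Rightarrow> ('h \<Rightarrow>\<^sub>L 'h) \<Rightarrow> bool" where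
  "inverse_operators A B \<longleftrightarrow> A o\<^sub>L B = id_blinfun \<and> B o\<^sub>L A = id_blinfun"

definition spectrum :: "('h::complex_normed_vector \<Rightarrow>\<^sub>L 'h) \<Rightarrow> complex set" where
  "spectrum T = {z. \<not> (\<exists>R. inverse_operators (z *\<^sub>C id_blinfun - T) R)}"

definition resolvent ::
    "('h::complex_normed_vector \<Rightarrow>\<^sub>L 'h) \<Rightarrow> complex \<Rightarrow> ('h \<Rightarrow>\<^sub>L 'h)" where
  "resolvent T z = (THE R. inverse_operators (z *\<^sub>C id_blinfun - T) R)"

text \<open>
  A cycle (finite list of closed piecewise continuously differentiable paths) in
  \<open>U - A\<close> that winds once around every point of \<open>A\<close> and not at all around the points
  outside \<open>U\<close>.
\<close>

definition surrounding_cycle ::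
    "complex set \<Rightarrow> complex set \<Rightarrow> (real \<Rightarrow> complex) list \<Rightarrow> bool" where
  "surrounding_cycle A U \<Gamma> \<longleftrightarrow>
     (\<forall>\<gamma> \<in> set \<Gamma>. valid_path \<gamma> \<and> pathfinish \<gamma> = pathstart \<gamma> \<and> path_image \<gamma> \<subseteq> U - A) \<and>
     (\<forall>z \<in> A. (\<Sum>\<gamma>\<leftarrow>\<Gamma>. winding_number \<gamma> z) = 1) \<and>
     (\<forall>z. z \<notin> U \<longrightarrow> (\<Sum>\<gamma>\<leftarrow>\<Gamma>. winding_number \<gamma> z) = 0)"

text \<open>
  The vector-valued counterpart of \<open>contour_integral\<close>.
\<close>

definition vector_contour_integral ::
    "(real \<Rightarrow> complex) \<Rightarrow> (complex \<Rightarrow> 'v::complex_normed_vector) \<Rightarrow> 'v" where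
  "vector_contour_integral \<gamma> F =
     integral {0..1} (\<lambda>t. vector_derivative \<gamma> (at t within {0..1}) *\<^sub>C F (\<gamma> t))"

text \<open>
  \<open>has_holomorphic_calculus f T S\<close> states that \<open>f(T) = S\<close>, where
  \<open>f(T) = 1/(2 \<pi> i) \<integral>\<^sub>\<Gamma> f(z) (z - T)\<inverse> dz\<close> is the Riesz--Dunford integral; the integral
  converges in operator norm. By Cauchy's theorem it does not depend on \<open>U\<close> and \<open>\<Gamma>\<close>, so
  for a complex-linear \<open>T\<close> on a complex Hilbert space and \<open>f\<close> holomorphic near the
  spectrum of \<open>T\<close> there is exactly one such \<open>S\<close>.
\<close>

definition has_holomorphic_calculus ::
    "(complex \<Rightarrow> complex) \<Rightarrow> ('h::complex_hilbert \<Rightarrow>\<^sub>L 'h) \<Rightarrow> ('h \<Rightarrow>\<^sub>L 'h) \<Rightarrow> bool" where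
  "has_holomorphic_calculus f T S \<longleftrightarrow>
     (\<exists>U \<Gamma>. open U \<and> spectrum T \<subseteq> U \<and> f holomorphic_on U \<and>
        surrounding_cycle (spectrum T) U \<Gamma> \<and>
        S = (1 / (2 * of_real pi * \<i>)) *\<^sub>C
              (\<Sum>\<gamma>\<leftarrow>\<Gamma>. vector_contour_integral \<gamma> (\<lambda>z. f z *\<^sub>C resolvent T z)))"


section \<open>Moebius bounded operators\<close>

definition disc_automorphism :: "(complex \<Rightarrow> complex) \<Rightarrow> bool" where
  "disc_automorphism \<phi> \<longleftrightarrow>
     \<phi> holomorphic_on ball 0 1 \<and> bij_betw \<phi> (ball 0 1) (ball 0 1) \<and>
     inv_into (ball 0 1) \<phi> holomorphic_on ball 0 1"

text \<open>
  The values of \<open>\<phi> :: complex \<Rightarrow> complex\<close> outside the open disc are not restricted by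
  \<open>disc_automorphism \<phi>\<close>. The functional calculus refers to the holomorphic extension of the
  automorphism to a neighbourhood of the closed disc, so \<open>\<phi>\<close> ranges over the representatives
  that are given by this extension there; every automorphism has such a representative.
\<close>

definition moebius_bounded :: "('h::complex_hilbert \<Rightarrow>\<^sub>L 'h) \<Rightarrow> bool" where
  "moebius_bounded T \<longleftrightarrow>
     complex_linear T \<and> spectrum T \<subseteq> cball 0 1 \<and>
     bdd_above {norm S | S \<phi>. disc_automorphism \<phi> \<and>
       (\<exists>V. open V \<and> cball 0 1 \<subseteq> V \<and> \<phi> holomorphic_on V) \<and>
       has_holomorphic_calculus \<phi> T S}"


section \<open>Reproducing kernel Hilbert spaces\<close>

definition positive_definite_kernel ::
    "complex set \<Rightarrow> (complex \<Rightarrow> complex \<Rightarrow> complex) \<Rightarrow> bool" where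
  "positive_definite_kernel X K \<longleftrightarrow>
     (\<forall>A c. finite A \<and> A \<subseteq> X \<longrightarrow>
        (\<Sum>z\<in>A. \<Sum>w\<in>A. c z * cnj (c w) * K z w) \<in> \<real>\<^sub>\<ge>\<^sub>0)"

text \<open>
  The elements of the Hilbert space \<open>'h\<close> are functions on \<open>X\<close>, where \<open>ev f z\<close> is the value
  of \<open>f\<close> at \<open>z\<close>: the vector space operations are pointwise, and an element is determined by
  its values on \<open>X\<close>. The functions \<open>K(\<cdot>, w)\<close> belong to the space and reproduce the values.
\<close>

definition reproducing_kernel_hilbert_space ::
    "complex set \<Rightarrow> (complex \<Rightarrow> complex \<Rightarrow> complex) \<Rightarrow>
      ('h::complex_hilbert \<Rightarrow> complex \<Rightarrow> complex) \<Rightarrow> bool" where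
  "reproducing_kernel_hilbert_space X K ev \<longleftrightarrow>
     (\<forall>f g. \<forall>z\<in>X. ev (f + g) z = ev f z + ev g z) \<and>
     (\<forall>c f. \<forall>z\<in>X. ev (c *\<^sub>C f) z = c * ev f z) \<and>
     (\<forall>f g. (\<forall>z\<in>X. ev f z = ev g z) \<longrightarrow> f = g) \<and>
     (\<forall>w\<in>X. \<exists>k. (\<forall>z\<in>X. ev k z = K z w) \<and> (\<forall>f. cinner f k = ev f w))"

definition multiplication_by_z ::
    "complex set \<Rightarrow> ('h::complex_hilbert \<Rightarrow> complex \<Rightarrow> complex) \<Rightarrow> ('h \<Rightarrow>\<^sub>L 'h) \<Rightarrow> bool" where
  "multiplication_by_z X ev M \<longleftrightarrow> (\<forall>f. \<forall>z\<in>X. ev (blinfun_apply M f) z = z * ev f z)"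

end

theory Submission
  imports Defs
begin

text \<open>
  The heart of the proof is a growth inequality for the coefficients: there is a constant \<open>D\<close> with
  \<open>\<Sum>n<N. b n \<le> D * (\<Sum>n=N..<2*N. b n)\<close> for all \<open>N \<ge> 1\<close> (\<open>block_sum_ge_partial_sum\<close>). Both claims
  follow from it. The blocks \<open>{N..<2*N}\<close> have sums of at least \<open>b 0 / D\<close>, so the series diverges. If
  \<open>n b n\<close> were bounded by \<open>B\<close>, each block sum would be at most \<open>B\<close>, hence each partial sum at most
  \<open>D B\<close>, against the divergence.

  The inequality comes from the Kreiss resolvent condition
  \<open>(1 - a) \<parallel>g\<parallel> \<le> C \<parallel>(1 - a M) g\<parallel>\<close> for \<open>0 < a < 1\<close> (\<open>moebius_bounded_imp_Kreiss\<close>), which is the form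
  in which Moebius boundedness is used: with \<open>\<phi>(z) = (z - a) / (1 - a z)\<close>, the vector \<open>(1 - a\<^sup>2) g\<close>
  is a combination of \<open>(1 - a M) g\<close> and its image under \<open>\<phi>(M)\<close>. That the Riesz--Dunford integral
  \<open>\<phi>(M)\<close> is multiplication by \<open>\<phi>\<close> is seen pointwise: evaluation at a point of the disc reduces it to
  Cauchy's integral formula (\<open>holomorphic_calculus_is_multiplication\<close>).

  The condition is tested at \<open>a = N / (N + 1)\<close> on the polynomial \<open>f = \<Sum>n<N. b n z\<^sup>n\<close>. The
  coefficients of \<open>(1 - a M)\<inverse> f\<close> with index between \<open>N\<close> and \<open>2 N\<close> are all comparable to the whole
  partial sum, while the norm of that function is controlled by the condition; a pairing with
  \<open>\<Sum>n=N..<2*N. b n z\<^sup>n\<close> turns this into the inequality. The pairing uses that the \<open>n\<close>-th Taylor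
  coefficient of a function \<open>h\<close> equals \<open>b n\<close> times the inner product of \<open>h\<close> with \<open>z\<^sup>n\<close>
  (\<open>coeff_sums\<close>, \<open>coeff_monomial\<close>).
\<close>

section \<open>Complex inner products\<close>

lemma bounded_bilinear_scaleC:
  "bounded_bilinear (\<lambda>c (x :: 'a::complex_normed_vector). c *\<^sub>C x)"
proof
  fix r :: real and c :: complex and x :: 'a
  show "(r *\<^sub>R c) *\<^sub>C x = r *\<^sub>R c *\<^sub>C x"
    by (simp only: scaleC_of_real[symmetric] scaleC_scaleC scaleR_conv_of_real)
  show "c *\<^sub>C r *\<^sub>R x = r *\<^sub>R c *\<^sub>C x"
    by (simp only: scaleC_of_real[symmetric] scaleC_scaleC mult.commute)
  show "\<exists>B. \<forall>c (x::'a). norm (c *\<^sub>C x) \<le> norm c * norm x * B"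
    by (rule exI[of _ 1]) (simp add: norm_scaleC)
qed (simp_all add: scaleC_add_right scaleC_add_left)

lemma cinner_add_right: "cinner x (y + z) = cinner x y + cinner x (z::'a::complex_inner)"
  by (metis cinner_commute cinner_add_left complex_cnj_add)

lemma cinner_scaleC_right: "cinner x (c *\<^sub>C y) = cnj c * cinner x (y::'a::complex_inner)"
  by (metis cinner_commute cinner_scaleC_left complex_cnj_mult)

lemma cinner_zero_right: "cinner (x::'a::complex_inner) 0 = 0"
  using cinner_add_right[of x 0 0] by simp

lemma cinner_sum_right:
  "cinner x (\<Sum>i\<in>A. f i) = (\<Sum>i\<in>A. cinner x (f i :: 'a::complex_inner))"
  by (induction A rule: infinite_finite_induct) (auto simp: cinner_zero_right cinner_add_right)

lemma cinner_self: "cinner x x = complex_of_real ((norm (x::'a::complex_inner))\<^sup>2)"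
proof -
  have "Im (cinner x x) = Im (cnj (cinner x x))"
    by (rule arg_cong[OF cinner_commute])
  then have "Im (cinner x x) = 0"
    by simp
  moreover have "Re (cinner x x) = (norm x)\<^sup>2"
    by (metis abs_norm_cancel norm_eq_sqrt_cinner norm_ge_zero real_sqrt_ge_0_iff real_sqrt_pow2)
  ultimately show ?thesis
    by (simp add: complex_eq_iff)
qed

lemma norm_cinner_le: "norm (cinner x y) \<le> norm x * norm (y::'a::complex_inner)"
proof (cases "y = 0")
  case True
  then show ?thesis by (simp add: cinner_zero_right)
next
  case False
  define c where "c = - (cinner x y / of_real ((norm y)\<^sup>2))"
  have yx: "cinner y x = cnj (cinner x y)"
    by (rule cinner_commute)
  have "complex_of_real ((norm (x + c *\<^sub>C y))\<^sup>2) =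
      cinner x x + c * cnj (cinner x y) + cnj c * (cinner x y + c * cinner y y)"
    unfolding cinner_self[symmetric] cinner_add_left cinner_add_right cinner_scaleC_left
      cinner_scaleC_right yx by (simp add: algebra_simps)
  also have "\<dots> = of_real ((norm x)\<^sup>2) - cinner x y * cnj (cinner x y) / of_real ((norm y)\<^sup>2)"
    using False by (simp add: c_def cinner_self field_simps)
  also have "\<dots> = of_real ((norm x)\<^sup>2 - (norm (cinner x y))\<^sup>2 / (norm y)\<^sup>2)"
    by (simp only: complex_norm_square[symmetric] of_real_diff of_real_divide)
  finally have "0 \<le> (norm x)\<^sup>2 - (norm (cinner x y))\<^sup>2 / (norm y)\<^sup>2"
    by (metis of_real_eq_iff zero_le_power2)
  then have "(norm (cinner x y))\<^sup>2 \<le> (norm x * norm y)\<^sup>2"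
    using False by (simp add: field_simps)
  then show ?thesis
    by (rule power2_le_imp_le) simp
qed

lemma bounded_linear_cinner_left: "bounded_linear (\<lambda>x. cinner x (y::'a::complex_inner))"
proof (rule bounded_linear_intro[where K = "norm y"])
  fix r :: real and x :: 'a
  show "cinner (r *\<^sub>R x) y = r *\<^sub>R cinner x y"
    by (simp only: scaleC_of_real[symmetric] cinner_scaleC_left scaleR_conv_of_real)
qed (simp_all add: cinner_add_left norm_cinner_le)

lemma cinner_diff_left: "cinner (x - y) z = cinner x z - cinner y (z::'a::complex_inner)"
  by (rule linear_diff[OF bounded_linear.linear[OF bounded_linear_cinner_left]])

lemma bounded_linear_cinner_right: "bounded_linear (\<lambda>y. cinner (x::'a::complex_inner) y)"
proof (rule bounded_linear_intro[where K = "norm x"])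
  fix r :: real and y :: 'a
  show "cinner x (r *\<^sub>R y) = r *\<^sub>R cinner x y"
    by (simp only: scaleC_of_real[symmetric] cinner_scaleC_right scaleR_conv_of_real
        complex_cnj_complex_of_real)
  show "norm (cinner x y) \<le> norm y * norm x"
    using norm_cinner_le[of x y] by (simp add: mult.commute)
qed (simp_all add: cinner_add_right)

section \<open>The resolvent and contour integrals of operators\<close>

lemma inverse_operators_resolvent:
  assumes "z \<notin> spectrum T"
  shows "inverse_operators (z *\<^sub>C id_blinfun - T) (resolvent T z)"
proof -
  obtain R where R: "inverse_operators (z *\<^sub>C id_blinfun - T) R"
    using assms by (auto simp: spectrum_def)
  have "R' = R" if "inverse_operators (z *\<^sub>C id_blinfun - T) R'" for R'
  proof (rule blinfun_eqI)
    fix x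
    have "(z *\<^sub>C id_blinfun - T) (R x) = x" "R' ((z *\<^sub>C id_blinfun - T) (R x)) = R x"
      using R that unfolding inverse_operators_def
      by (metis blinfun_apply_blinfun_compose blinfun_apply_id_blinfun)+
    then show "R' x = R x" by simp
  qed
  with R show ?thesis
    unfolding resolvent_def by (rule theI)
qed

lemma resolvent_right_inverse:
  assumes "z \<notin> spectrum T"
  shows "z *\<^sub>C resolvent T z x - T (resolvent T z x) = x"
proof -
  have "(z *\<^sub>C id_blinfun - T) (resolvent T z x) = x"
    using inverse_operators_resolvent[OF assms] unfolding inverse_operators_def
    by (metis blinfun_apply_blinfun_compose blinfun_apply_id_blinfun)
  then show ?thesis
    by (simp add: blinfun.diff_left scaleC_blinfun.rep_eq)
qed

lemma resolvent_left_inverse: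
  assumes "z \<notin> spectrum T"
  shows "resolvent T z (z *\<^sub>C x - T x) = x"
proof -
  have "resolvent T z ((z *\<^sub>C id_blinfun - T) x) = x"
    using inverse_operators_resolvent[OF assms] unfolding inverse_operators_def
    by (metis blinfun_apply_blinfun_compose blinfun_apply_id_blinfun)
  then show ?thesis
    by (simp add: blinfun.diff_left scaleC_blinfun.rep_eq)
qed

text \<open>
  This is the resolvent identity \<open>R(z) - R(w) = R(z) (w - z) R(w)\<close>. The
  scalar stays between the two resolvents, because a real-linear \<open>R(z)\<close> need not commute with it.
\<close>

lemma norm_resolvent_diff_le:
  assumes "z \<notin> spectrum T" "w \<notin> spectrum T"
  shows "norm (resolvent T z - resolvent T w) \<le>
           norm (w - z) * norm (resolvent T z) * norm (resolvent T w)"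
proof (rule norm_blinfun_bound)
  fix x
  let ?u = "resolvent T w x"
  have "x - (z *\<^sub>C ?u - T ?u) = (w - z) *\<^sub>C ?u"
    using resolvent_right_inverse[OF assms(2), of x]
      scaleC_add_left[of "w - z" z ?u] by (simp add: algebra_simps)
  then have "(resolvent T z - resolvent T w) x = resolvent T z ((w - z) *\<^sub>C ?u)"
    using resolvent_left_inverse[OF assms(1), of ?u]
    by (metis blinfun.diff_left blinfun.diff_right)
  then have "norm ((resolvent T z - resolvent T w) x) \<le> norm (resolvent T z) * norm ((w - z) *\<^sub>C ?u)"
    by (metis norm_blinfun)
  also have "\<dots> \<le> norm (resolvent T z) * (norm (w - z) * (norm (resolvent T w) * norm x))"
    by (simp only: norm_scaleC) (intro mult_left_mono norm_blinfun norm_ge_zero)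
  finally show "norm ((resolvent T z - resolvent T w) x) \<le>
      norm (w - z) * norm (resolvent T z) * norm (resolvent T w) * norm x"
    by (simp add: mult_ac)
qed simp

text \<open>
  Near \<open>z\<close> the resolvent identity bounds \<open>\<parallel>R(w)\<parallel>\<close> by \<open>2 \<parallel>R(z)\<parallel>\<close>; inserted into the identity
  once more, this bound shows that \<open>R(w)\<close> tends to \<open>R(z)\<close>.
\<close>

lemma continuous_on_resolvent: "continuous_on (- spectrum T) (resolvent T)"
  unfolding continuous_on_eq_continuous_within continuous_within
proof
  fix z assume "z \<in> - spectrum T"
  then have z: "z \<notin> spectrum T" by simp
  let ?F = "at z within - spectrum T"
  have lim: "((\<lambda>w. norm (w - z) * c) \<longlongrightarrow> 0) ?F" for c :: real
    by (auto intro!: tendsto_eq_intros)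
  have "\<forall>\<^sub>F w in ?F. norm (w - z) * norm (resolvent T z) < 1 / 2"
    using order_tendstoD(2)[OF lim, of "1 / 2"] by simp
  moreover have "\<forall>\<^sub>F w in ?F. w \<notin> spectrum T"
    by (auto simp: eventually_at_filter)
  ultimately have "\<forall>\<^sub>F w in ?F. norm (resolvent T w - resolvent T z) \<le>
      norm (w - z) * (2 * (norm (resolvent T z))\<^sup>2)"
  proof eventually_elim
    case w: (elim w)
    let ?d = "norm (w - z)" and ?r = "norm (resolvent T z)" and ?s = "norm (resolvent T w)"
    have diff: "norm (resolvent T w - resolvent T z) \<le> ?d * ?r * ?s"
      using norm_resolvent_diff_le[OF z w(2)] by (simp add: norm_minus_commute)
    have "?s \<le> ?r + norm (resolvent T w - resolvent T z)"
      by (rule norm_triangle_sub)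
    also have "\<dots> \<le> ?r + (1 / 2) * ?s"
      using diff mult_right_mono[of "?d * ?r" "1 / 2" ?s] w(1) by simp
    finally have "?d * ?r * ?s \<le> ?d * ?r * (2 * ?r)"
      by (intro mult_left_mono) auto
    with diff show "norm (resolvent T w - resolvent T z) \<le> ?d * (2 * ?r\<^sup>2)"
      by (simp add: power2_eq_square mult_ac)
  qed
  then have "((\<lambda>w. resolvent T w - resolvent T z) \<longlongrightarrow> 0) ?F"
    by (rule Lim_null_comparison[OF _ lim])
  then show "(resolvent T \<longlongrightarrow> resolvent T z) ?F"
    by (rule LIM_zero_cancel)
qed

text \<open>
  The integrand of the Riesz--Dunford integral is norm continuous, so every bounded functional
  may be applied under the integral sign.
\<close>

lemma vector_contour_integral_circlepath_linear:
  fixes F :: "complex \<Rightarrow> 'v::{complex_normed_vector,banach}" and h :: "'v \<Rightarrow> complex"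
  assumes "continuous_on (path_image (circlepath c r)) F" "bounded_linear h"
    and h: "\<And>a x. h (a *\<^sub>C x) = a * h x"
    and I: "((\<lambda>z. h (F z)) has_contour_integral I) (circlepath c r)"
  shows "h (vector_contour_integral (circlepath c r) F) = I"
proof -
  let ?g = "circlepath c r"
  let ?f = "\<lambda>t. vector_derivative ?g (at t within {0..1}) *\<^sub>C F (?g t)"
  have "continuous_on {0..1} (\<lambda>t. (2 * pi * \<i> * r * exp (2 * of_real pi * \<i> * t)) *\<^sub>C F (?g t))"
    using assms(1)
    by (intro bounded_bilinear.continuous_on[OF bounded_bilinear_scaleC] continuous_intros
        continuous_on_compose2[OF assms(1)])
      (auto simp: path_image_def simp flip: path_def intro: path_circlepath)
  then have "?f integrable_on {0..1}"
    by (rule integrable_eq[OF integrable_continuous_interval])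
      (simp add: vector_derivative_circlepath01)
  then have "((h \<circ> ?f) has_integral h (vector_contour_integral ?g F)) {0..1}"
    unfolding vector_contour_integral_def
    by (intro has_integral_linear integrable_integral assms(2))
  then have "((\<lambda>z. h (F z)) has_contour_integral h (vector_contour_integral ?g F)) ?g"
    by (simp add: has_contour_integral_def h o_def mult.commute)
  then show ?thesis
    by (rule has_contour_integral_unique[OF _ I])
qed

section \<open>Power series and automorphisms of the disc\<close>

lemma powser_coeffs_unique:
  fixes a c :: "nat \<Rightarrow> complex"
  assumes r: "0 < r" and a: "\<And>w. norm w < r \<Longrightarrow> (\<lambda>n. a n * w ^ n) sums f w"
    and c: "\<And>w. norm w < r \<Longrightarrow> (\<lambda>n. c n * w ^ n) sums f w"
  shows "a = c"
proof (rule ccontr)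
  assume "a \<noteq> c"
  then obtain m where m: "a m - c m \<noteq> 0" by (auto simp: fun_eq_iff)
  have d: "(\<lambda>n. (a n - c n) * w ^ n) sums 0" if "norm w < r" for w
    using sums_diff[OF a[OF that] c[OF that]] by (simp add: algebra_simps)
  show False
  proof (cases "m = 0")
    case True
    with d[of 0] r m show False by simp
  next
    case False
    show False
    proof (rule powser_0_nonzero[where a = "\<lambda>n. a n - c n" and \<xi> = "0::complex"
          and f = "\<lambda>_. 0" and r = r and m = m])
      fix s :: real
      assume "0 < s" and nz: "\<And>z. z \<in> cball 0 s - {0::complex} \<Longrightarrow> (0::complex) \<noteq> 0"
      with nz[of "of_real s"] show False by simp
    qed (use d r m False in auto)
  qed
qed

lemma disc_automorphism_Moebius_function:
  assumes "norm a < 1"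
  shows "disc_automorphism (Moebius_function 0 a)"
proof -
  let ?f = "Moebius_function 0 a" and ?g = "Moebius_function 0 (- a)"
  have fg: "?f (?g z) = z" and gf: "?g (?f z) = z" if "z \<in> ball 0 1" for z
    using that assms by (auto intro!: Moebius_function_compose)
  have maps: "?f z \<in> ball 0 1" "?g z \<in> ball 0 1" if "z \<in> ball 0 1" for z
    using that assms by (auto intro: Moebius_function_norm_lt_1)
  have bij: "bij_betw ?f (ball 0 1) (ball 0 1)"
    by (rule bij_betw_byWitness[where f' = ?g]) (use fg gf maps in auto)
  have "inv_into (ball 0 1) ?f w = ?g w" if "w \<in> ball 0 1" for w
    using that bij fg maps by (intro inv_into_f_eq) (auto simp: bij_betw_def)
  then have "inv_into (ball 0 1) ?f holomorphic_on ball 0 1"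
    using holomorphic_transform[OF Moebius_function_holomorphic[of "- a" 0]] assms by simp
  with bij assms show ?thesis
    by (simp add: disc_automorphism_def Moebius_function_holomorphic)
qed

section \<open>The functional calculus of the multiplication operator\<close>

locale diagonal_kernel_space =
  fixes b :: "nat \<Rightarrow> real"
    and K :: "complex \<Rightarrow> complex \<Rightarrow> complex"
    and ev :: "'h::complex_hilbert \<Rightarrow> complex \<Rightarrow> complex"
    and M :: "'h \<Rightarrow>\<^sub>L 'h"
  assumes b_pos: "b n > 0"
    and K_sums: "z \<in> ball 0 1 \<Longrightarrow> w \<in> ball 0 1 \<Longrightarrow>
                   (\<lambda>n. of_real (b n) * (z * cnj w) ^ n) sums K z w"
    and rkhs: "reproducing_kernel_hilbert_space (ball 0 1) K ev"
    and multiplication: "multiplication_by_z (ball 0 1) ev M"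
begin

lemma ev_M: "z \<in> ball 0 1 \<Longrightarrow> ev (M f) z = z * ev f z"
  using multiplication by (simp add: multiplication_by_z_def)

lemma ev_eqI: "(\<And>z. z \<in> ball 0 1 \<Longrightarrow> ev f z = ev g z) \<Longrightarrow> f = g"
  using rkhs unfolding reproducing_kernel_hilbert_space_def by blast

definition kern :: "complex \<Rightarrow> 'h" where
  "kern w = (SOME k. (\<forall>z\<in>ball 0 1. ev k z = K z w) \<and> (\<forall>f. cinner f k = ev f w))"

lemma kern:
  assumes "w \<in> ball 0 1"
  shows ev_kern: "z \<in> ball 0 1 \<Longrightarrow> ev (kern w) z = K z w"
    and ev_eq_cinner: "ev f w = cinner f (kern w)"
proof -
  have "\<exists>k. (\<forall>z\<in>ball 0 1. ev k z = K z w) \<and> (\<forall>f. cinner f k = ev f w)"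
    using rkhs assms unfolding reproducing_kernel_hilbert_space_def by blast
  from someI_ex[OF this]
  show "z \<in> ball 0 1 \<Longrightarrow> ev (kern w) z = K z w" "ev f w = cinner f (kern w)"
    unfolding kern_def by auto
qed

lemma ev_add: "w \<in> ball 0 1 \<Longrightarrow> ev (f + g) w = ev f w + ev g w"
  by (simp add: ev_eq_cinner cinner_add_left)

lemma ev_scaleC: "w \<in> ball 0 1 \<Longrightarrow> ev (c *\<^sub>C f) w = c * ev f w"
  by (simp add: ev_eq_cinner cinner_scaleC_left)

lemma bounded_linear_ev: "w \<in> ball 0 1 \<Longrightarrow> bounded_linear (\<lambda>f. ev f w)"
  by (simp add: ev_eq_cinner bounded_linear_cinner_left)

lemma ev_diff: "w \<in> ball 0 1 \<Longrightarrow> ev (f - g) w = ev f w - ev g w"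
  by (simp add: ev_eq_cinner cinner_diff_left)

text \<open>
  If \<open>g = (z - M)\<inverse> f\<close>, then \<open>(z - w) g(w) = f(w)\<close> at each point \<open>w\<close> of the disc.
\<close>

lemma ev_resolvent:
  assumes "z \<notin> spectrum M" "1 \<le> norm z" "w \<in> ball 0 1"
  shows "ev (resolvent M z f) w = ev f w / (z - w)"
proof -
  have "z \<noteq> w" using assms by auto
  have "ev f w = z * ev (resolvent M z f) w - w * ev (resolvent M z f) w"
    using arg_cong[OF resolvent_right_inverse[OF assms(1), of f], of "\<lambda>g. ev g w"] assms(3)
    by (simp add: ev_diff ev_scaleC ev_M)
  with \<open>z \<noteq> w\<close> show ?thesis by (simp add: field_simps)
qed

text \<open>
  Evaluation at a point \<open>w\<close> of the disc is a bounded functional and turns the operator-valued integral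
  of \<open>\<phi>(z) (z - M)\<inverse> f\<close> into the scalar integral of \<open>\<phi>(z) f(w) / (z - w)\<close>. Its value is given by
  Cauchy's integral formula, since \<open>\<phi>\<close> is holomorphic inside the circle.
\<close>

lemma holomorphic_calculus_is_multiplication:
  assumes spec: "spectrum M \<subseteq> cball 0 1" and "1 < R" and holo: "\<phi> holomorphic_on ball 0 R"
  obtains S where "has_holomorphic_calculus \<phi> M S"
    and "\<And>f w. w \<in> ball 0 1 \<Longrightarrow> ev (S f) w = \<phi> w * ev f w"
proof -
  \<comment> \<open>The circle has to surround the closed disc, where the spectrum lies, and to stay inside the domain of \<open>\<phi>\<close>.\<close>
  define \<rho> where "\<rho> = (1 + R) / 2"
  have \<rho>: "1 < \<rho>" "\<rho> < R" using \<open>1 < R\<close> by (auto simp: \<rho>_def)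
  let ?\<gamma> = "circlepath 0 \<rho>" and ?F = "\<lambda>z. \<phi> z *\<^sub>C resolvent M z"
  define S where "S = (1 / (2 * of_real pi * \<i>)) *\<^sub>C vector_contour_integral ?\<gamma> ?F"
  have img: "path_image ?\<gamma> = sphere 0 \<rho>" using \<rho> by simp
  have off: "z \<notin> spectrum M" "1 \<le> norm z" if "z \<in> sphere 0 \<rho>" for z
    using that spec \<rho> by auto
  have "surrounding_cycle (spectrum M) (ball 0 R) [?\<gamma>]"
    unfolding surrounding_cycle_def
  proof (intro conjI ballI allI impI)
    fix z assume "z \<in> spectrum M"
    with spec \<rho> have "norm (z - 0) < \<rho>" by auto
    then show "(\<Sum>\<gamma>\<leftarrow>[?\<gamma>]. winding_number \<gamma> z) = 1"
      by (simp add: winding_number_circlepath del: diff_zero)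
  next
    fix z :: complex assume z: "z \<notin> ball 0 R"
    have "winding_number ?\<gamma> z = 0"
      by (rule winding_number_zero_outside[OF _ convex_ball[of 0 R]])
        (use z \<rho> in \<open>auto simp: valid_path_imp_path\<close>)
    then show "(\<Sum>\<gamma>\<leftarrow>[?\<gamma>]. winding_number \<gamma> z) = 0" by simp
  qed (use off \<rho> img in auto)
  then have calculus: "has_holomorphic_calculus \<phi> M S"
    unfolding has_holomorphic_calculus_def
    using spec \<open>1 < R\<close> holo
    by (intro exI[of _ "ball 0 R"] exI[of _ "[?\<gamma>]"]) (auto simp: S_def)
  have cont: "continuous_on (path_image ?\<gamma>) ?F"
    unfolding img
    by (intro bounded_bilinear.continuous_on[OF bounded_bilinear_scaleC]
        continuous_on_subset[OF holomorphic_on_imp_continuous_on[OF holo]]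
        continuous_on_subset[OF continuous_on_resolvent])
      (use \<rho> off in auto)
  have "ev (S f) w = \<phi> w * ev f w" if w: "w \<in> ball 0 1" for f w
  proof -
    have "((\<lambda>z. \<phi> z / (z - w)) has_contour_integral (complex_of_real (2 * pi) * \<i> * winding_number ?\<gamma> w * \<phi> w)) ?\<gamma>"
      by (rule Cauchy_integral_formula_convex_simple[OF convex_ball holo]) (use w \<rho> in auto)
    moreover have "winding_number ?\<gamma> w = 1"
      by (rule winding_number_circlepath) (use w \<rho> in auto)
    ultimately have "((\<lambda>z. \<phi> z / (z - w) * ev f w) has_contour_integral
        (complex_of_real (2 * pi) * \<i> * \<phi> w * ev f w)) ?\<gamma>"
      using has_contour_integral_rmul by fastforce
    then have integral: "((\<lambda>z. ev (blinfun_apply (?F z) f) w) has_contour_integral (complex_of_real (2 * pi) * \<i> * \<phi> w * ev f w)) ?\<gamma>"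
      by (rule has_contour_integral_eq)
        (use off \<rho> w in \<open>auto simp: scaleC_blinfun.rep_eq ev_scaleC ev_resolvent\<close>)
    have "ev (blinfun_apply (vector_contour_integral ?\<gamma> ?F) f) w = complex_of_real (2 * pi) * \<i> * \<phi> w * ev f w"
      by (rule vector_contour_integral_circlepath_linear[where h = "\<lambda>A. ev (blinfun_apply A f) w",
            OF cont _ _ integral])
        (use w in \<open>auto intro: bounded_linear_compose[OF bounded_linear_ev[OF w]]
          blinfun.bounded_linear_left simp: scaleC_blinfun.rep_eq ev_scaleC\<close>)
    then show ?thesis
      using w by (simp add: S_def scaleC_blinfun.rep_eq ev_scaleC)
  qed
  with calculus show ?thesis by (rule that)
qed

text \<open>
  For \<open>\<phi>(z) = (z - a) / (1 - a z)\<close> one has \<open>1 - a\<^sup>2 = (1 - a z) (1 + a \<phi>(z))\<close>. Since \<open>\<phi>(M)\<close> is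
  multiplication by \<open>\<phi>\<close>, this reads \<open>(1 - a\<^sup>2) g = (1 + a \<phi>(M)) (1 - a M) g\<close>, and a bound on the
  norms of the operators \<open>\<phi>(M)\<close> becomes the Kreiss resolvent condition on the radius.
\<close>

lemma moebius_bounded_imp_Kreiss:
  assumes "moebius_bounded M"
  obtains C where "0 < C"
    and "\<And>a g. 0 < a \<Longrightarrow> a < 1 \<Longrightarrow> (1 - a) * norm g \<le> C * norm (g - complex_of_real a *\<^sub>C M g)"
proof -
  have spec: "spectrum M \<subseteq> cball 0 1" using assms by (simp add: moebius_bounded_def)
  obtain B where bound: "\<forall>x \<in> {norm S | S \<phi>. disc_automorphism \<phi> \<and>
      (\<exists>V. open V \<and> cball 0 1 \<subseteq> V \<and> \<phi> holomorphic_on V) \<and> has_holomorphic_calculus \<phi> M S}. x \<le> B"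
    using assms unfolding moebius_bounded_def bdd_above.unfold by (elim conjE exE)
  have B: "norm S \<le> B" if "disc_automorphism \<phi>" "open V" "cball 0 1 \<subseteq> V" "\<phi> holomorphic_on V"
    "has_holomorphic_calculus \<phi> M S" for S \<phi> V
    using that by (intro bound[THEN bspec] CollectI exI[of _ S] exI[of _ \<phi>] exI[of _ V] conjI refl)
  have "(1 - a) * norm g \<le> (1 + \<bar>B\<bar>) * norm (g - complex_of_real a *\<^sub>C M g)"
    if a: "0 < a" "a < 1" for a g
  proof -
    let ?\<phi> = "Moebius_function 0 (complex_of_real a)" and ?h = "g - complex_of_real a *\<^sub>C M g"
    have holo: "?\<phi> holomorphic_on ball 0 (1 / a)"
      unfolding Moebius_function_simple
    proof (intro holomorphic_intros)
      fix z :: complex assume "z \<in> ball 0 (1 / a)"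
      then have "norm (cnj (of_real a) * z) < 1"
        using a by (simp add: norm_mult field_simps)
      then show "1 - cnj (of_real a) * z \<noteq> 0" by auto
    qed
    have R: "1 < 1 / a" using a by simp
    have sub: "cball 0 1 \<subseteq> (ball 0 (1 / a) :: complex set)"
      using le_less_trans[OF _ R] by auto
    obtain S where S: "has_holomorphic_calculus ?\<phi> M S"
      and mult: "\<And>f w. w \<in> ball 0 1 \<Longrightarrow> ev (S f) w = ?\<phi> w * ev f w"
      using holomorphic_calculus_is_multiplication[OF spec R holo] by blast
    have "norm S \<le> B"
      by (rule B[OF _ _ _ holo S]) (use a sub in \<open>auto intro: disc_automorphism_Moebius_function\<close>)
    have "complex_of_real (1 - a\<^sup>2) *\<^sub>C g = ?h + complex_of_real a *\<^sub>C S ?h"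
    proof (rule ev_eqI)
      fix w :: complex assume w: "w \<in> ball 0 1"
      then have "norm (of_real a * w) < 1"
        using a mult_strict_mono[of a 1 "norm w" 1] by (simp add: norm_mult)
      then have "1 - of_real a * w \<noteq> 0" by auto
      then show "ev (complex_of_real (1 - a\<^sup>2) *\<^sub>C g) w = ev (?h + complex_of_real a *\<^sub>C S ?h) w"
        using w by (simp add: ev_add ev_diff ev_scaleC ev_M mult Moebius_function_simple
            field_simps power2_eq_square)
    qed
    moreover have "norm (complex_of_real (1 - a\<^sup>2) *\<^sub>C g) = (1 - a\<^sup>2) * norm g"
      using a by (simp only: norm_scaleC norm_of_real) (simp add: abs_of_nonneg power_le_one)
    ultimately have "(1 - a\<^sup>2) * norm g \<le> norm ?h + a * norm (S ?h)"
      using a norm_triangle_ineq[of ?h "complex_of_real a *\<^sub>C S ?h"] by (simp add: norm_scaleC)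
    also have "a * norm (S ?h) \<le> 1 * (norm S * norm ?h)"
      using a by (intro mult_mono norm_blinfun) auto
    also have "norm S * norm ?h \<le> \<bar>B\<bar> * norm ?h"
      using \<open>norm S \<le> B\<close> by (intro mult_right_mono) auto
    finally have "(1 - a\<^sup>2) * norm g \<le> (1 + \<bar>B\<bar>) * norm ?h"
      by (simp add: algebra_simps)
    moreover have "(1 - a) * norm g \<le> (1 - a\<^sup>2) * norm g"
      using a by (intro mult_right_mono) (auto simp: power2_eq_square mult_left_le_one_le)
    ultimately show ?thesis by linarith
  qed
  then show ?thesis by (intro that[of "1 + \<bar>B\<bar>"]) auto
qed

end

section \<open>Taylor coefficients as inner products\<close>

context diagonal_kernel_space
begin

text \<open>
  The function \<open>K(\<cdot>, 0)\<close> is the constant \<open>b 0\<close>, so the monomials arise from it by repeated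
  application of \<open>M\<close>; in particular they belong to the space.
\<close>

definition monomial :: "nat \<Rightarrow> 'h" where
  "monomial n = (blinfun_apply M ^^ n) (complex_of_real (1 / b 0) *\<^sub>C kern 0)"

lemma monomial_Suc: "monomial (Suc n) = M (monomial n)"
  by (simp add: monomial_def)

lemma ev_monomial:
  assumes "z \<in> ball 0 1"
  shows "ev (monomial n) z = z ^ n"
proof (induction n)
  case 0
  have "(\<lambda>n. of_real (b n) * 0 ^ n) sums K z 0"
    using K_sums[OF assms, of 0] by simp
  then have "K z 0 = of_real (b 0)"
    by simp
  then show ?case
    using assms b_pos[of 0] by (simp add: monomial_def ev_scaleC ev_kern)
next
  case (Suc n)
  then show ?case using assms by (simp add: monomial_Suc ev_M)
qed

lemma norm_monomial_le: "norm (monomial n) \<le> norm M ^ n * norm (monomial 0)"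
proof (induction n)
  case (Suc n)
  have "norm (monomial (Suc n)) \<le> norm M * norm (monomial n)"
    unfolding monomial_Suc by (rule norm_blinfun)
  also have "\<dots> \<le> norm M * (norm M ^ n * norm (monomial 0))"
    by (rule mult_left_mono[OF Suc]) simp
  finally show ?case by simp
qed simp

text \<open>
  For \<open>w\<close> within this radius, \<open>\<parallel>w\<^sup>n M\<^sup>n\<parallel> \<le> (1 / 2)\<^sup>n\<close>, while \<open>\<Sum> b n (1 / 2)\<^sup>n\<close> converges. A
  neighbourhood of \<open>0\<close> is enough, because power series are determined there.
\<close>

definition expansion_radius :: real where
  "expansion_radius = 1 / (2 * (1 + norm M))"

lemma expansion_radius: "0 < expansion_radius" "expansion_radius < 1"
  by (auto simp: expansion_radius_def field_simps add_pos_nonneg intro: add_pos_nonneg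
      order.strict_trans2[OF _ norm_ge_zero])

text \<open>
  The series \<open>\<Sum> b n (cnj w)\<^sup>n z\<^sup>n\<close> converges in norm for small \<open>w\<close>, and its sum has the same values
  as \<open>K(\<cdot>, w)\<close>. This expansion of the reproducing elements is what makes the Taylor coefficients of
  \<open>f\<close> accessible as inner products of \<open>f\<close> with monomials.
\<close>

lemma kern_sums:
  assumes w: "norm w < expansion_radius"
  shows "(\<lambda>n. (of_real (b n) * cnj w ^ n) *\<^sub>C monomial n) sums kern w"
proof -
  let ?t = "\<lambda>n. (of_real (b n) * cnj w ^ n) *\<^sub>C monomial n"
  have w1: "w \<in> ball 0 1" using w expansion_radius by simp
  \<comment> \<open>Two points of the disc with product \<open>1 / 2\<close>.\<close>
  have "(\<lambda>n. complex_of_real (b n) * (3 / 4 * cnj (2 / 3)) ^ n) sums K (3 / 4) (2 / 3)"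
    by (rule K_sums) auto
  then have "summable (\<lambda>n. Re (complex_of_real (b n) * (3 / 4 * cnj (2 / 3)) ^ n))"
    by (intro summable_Re sums_summable)
  moreover have "Re (complex_of_real (b n) * (3 / 4 * cnj (2 / 3)) ^ n) = b n * (1 / 2) ^ n" for n
  proof -
    have "complex_of_real (b n) * (3 / 4 * cnj (2 / 3)) ^ n = of_real (b n * (1 / 2) ^ n)"
      by simp
    then show ?thesis by (simp only: Re_complex_of_real)
  qed
  ultimately have "summable (\<lambda>n. b n * (1 / 2) ^ n * norm (monomial 0))"
    by (intro summable_mult2) simp
  moreover have "norm (?t n) \<le> b n * (1 / 2) ^ n * norm (monomial 0)" for n
  proof -
    have "norm w * norm M \<le> 1 / 2"
    proof -
      have "norm w * norm M \<le> expansion_radius * (1 + norm M)"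
        using w expansion_radius by (intro mult_mono) auto
      also have "\<dots> = 1 / 2"
        using norm_ge_zero[of M] by (simp add: expansion_radius_def field_simps add_nonneg_eq_0_iff)
      finally show ?thesis .
    qed
    then have "(norm w * norm M) ^ n \<le> (1 / 2) ^ n"
      by (intro power_mono) auto
    have "norm (?t n) = b n * (norm w ^ n * norm (monomial n))"
      using b_pos[of n] by (simp add: norm_scaleC norm_mult norm_power)
    also have "\<dots> \<le> b n * (norm w ^ n * (norm M ^ n * norm (monomial 0)))"
      using b_pos[of n] by (intro mult_left_mono norm_monomial_le) auto
    also have "\<dots> = b n * ((norm w * norm M) ^ n * norm (monomial 0))"
      by (simp add: power_mult_distrib)
    also have "\<dots> \<le> b n * ((1 / 2) ^ n * norm (monomial 0))"
      using b_pos[of n] \<open>(norm w * norm M) ^ n \<le> (1 / 2) ^ n\<close> by (intro mult_left_mono mult_right_mono) auto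
    finally show ?thesis by (simp add: mult.assoc)
  qed
  ultimately have "summable ?t"
    by (rule summable_comparison_test'[where N = 0])
  then have t: "?t sums suminf ?t" by (rule summable_sums)
  have "suminf ?t = kern w"
  proof (rule ev_eqI)
    fix z :: complex assume z: "z \<in> ball 0 1"
    have "(\<lambda>n. ev (?t n) z) sums ev (suminf ?t) z"
      by (rule bounded_linear.sums[OF bounded_linear_ev[OF z] t])
    moreover have "ev (?t n) z = of_real (b n) * (z * cnj w) ^ n" for n
      using z by (simp add: ev_scaleC ev_monomial power_mult_distrib)
    ultimately show "ev (suminf ?t) z = ev (kern w) z"
      using K_sums[OF z w1] z w1 by (simp add: ev_kern sums_unique2)
  qed
  with t show ?thesis by simp
qed

text \<open>
  These are the Taylor coefficients of \<open>f\<close> at \<open>0\<close>, by the next lemma.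
\<close>

definition coeff :: "'h \<Rightarrow> nat \<Rightarrow> complex" where
  "coeff f n = of_real (b n) * cinner f (monomial n)"

lemma coeff_sums:
  assumes "norm w < expansion_radius"
  shows "(\<lambda>n. coeff f n * w ^ n) sums ev f w"
proof -
  have "(\<lambda>n. cinner f ((of_real (b n) * cnj w ^ n) *\<^sub>C monomial n)) sums cinner f (kern w)"
    by (rule bounded_linear.sums[OF bounded_linear_cinner_right kern_sums[OF assms]])
  then show ?thesis
    using assms expansion_radius
    by (simp add: ev_eq_cinner cinner_scaleC_right coeff_def mult_ac)
qed

lemma coeff_eqI:
  assumes "\<And>w. norm w < expansion_radius \<Longrightarrow> (\<lambda>n. c n * w ^ n) sums ev f w"
  shows "coeff f n = c n"
  using powser_coeffs_unique[OF expansion_radius(1) coeff_sums assms] by (simp add: fun_eq_iff)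

text \<open>
  Written out with the definition of \<open>coeff\<close>, this is the orthogonality of the monomials together
  with \<open>\<parallel>z\<^sup>n\<parallel>\<^sup>2 = 1 / b n\<close>.
\<close>

lemma coeff_monomial: "coeff (monomial m) n = (if n = m then 1 else 0)"
proof (rule coeff_eqI)
  fix w :: complex assume "norm w < expansion_radius"
  then show "(\<lambda>n. (if n = m then 1 else 0) * w ^ n) sums ev (monomial m) w"
    using sums_single[of m "\<lambda>n. w ^ n"] expansion_radius
    by (simp add: ev_monomial if_distrib[of "\<lambda>x. x * _"] cong: if_cong)
qed

lemma coeff_M: "coeff (M f) n = (case n of 0 \<Rightarrow> 0 | Suc m \<Rightarrow> coeff f m)"
proof (rule coeff_eqI)
  fix w :: complex assume w: "norm w < expansion_radius"
  have "(\<lambda>n. w * (coeff f n * w ^ n)) sums (w * ev f w)"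
    by (rule sums_mult[OF coeff_sums[OF w]])
  then have "(\<lambda>n. (case Suc n of 0 \<Rightarrow> 0 | Suc m \<Rightarrow> coeff f m) * w ^ Suc n) sums (w * ev f w)"
    by (simp add: mult_ac)
  from sums_Suc[OF this]
  show "(\<lambda>n. (case n of 0 \<Rightarrow> 0 | Suc m \<Rightarrow> coeff f m) * w ^ n) sums ev (M f) w"
    using w expansion_radius by (simp add: ev_M)
qed

lemma coeff_diff: "coeff (f - g) n = coeff f n - coeff g n"
  by (simp add: coeff_def cinner_diff_left right_diff_distrib)

lemma coeff_scaleC: "coeff (c *\<^sub>C f) n = c * coeff f n"
  by (simp add: coeff_def cinner_scaleC_left)

text \<open>
  The part of the formal series \<open>K(\<cdot>, 1) = \<Sum> b n z\<^sup>n\<close> with exponents in \<open>A\<close>. It is the element of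
  the space that represents the sum of the coefficients with index in \<open>A\<close>.
\<close>

definition kernel_section :: "nat set \<Rightarrow> 'h" where
  "kernel_section A = (\<Sum>n\<in>A. complex_of_real (b n) *\<^sub>C monomial n)"

lemma cinner_kernel_section: "cinner f (kernel_section A) = (\<Sum>n\<in>A. coeff f n)"
  by (simp add: kernel_section_def cinner_sum_right cinner_scaleC_right coeff_def)

lemma coeff_kernel_section:
  assumes "finite A"
  shows "coeff (kernel_section A) n = (if n \<in> A then of_real (b n) else 0)"
proof -
  have "coeff (kernel_section A) n = (\<Sum>m\<in>A. coeff (complex_of_real (b m) *\<^sub>C monomial m) n)"
    unfolding coeff_def kernel_section_def
    by (simp add: linear_sum[OF bounded_linear.linear[OF bounded_linear_cinner_left]] sum_distrib_left)
  also have "\<dots> = (\<Sum>m\<in>A. if n = m then complex_of_real (b m) else 0)"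
    by (intro sum.cong) (auto simp: coeff_scaleC coeff_monomial)
  finally show ?thesis using assms by (simp add: sum.delta)
qed

lemma norm_kernel_section:
  assumes "finite A"
  shows "(norm (kernel_section A))\<^sup>2 = (\<Sum>n\<in>A. b n)"
proof -
  have "complex_of_real ((norm (kernel_section A))\<^sup>2) = (\<Sum>n\<in>A. coeff (kernel_section A) n)"
    by (simp only: cinner_self[symmetric] cinner_kernel_section)
  also have "\<dots> = of_real (\<Sum>n\<in>A. b n)"
    using assms by (simp add: coeff_kernel_section)
  finally show ?thesis by (simp only: of_real_eq_iff)
qed

lemma coeff_solution:
  assumes "g - complex_of_real a *\<^sub>C M g = f"
  shows "coeff g n = (\<Sum>k\<le>n. of_real a ^ (n - k) * coeff f k)"
proof (induction n)
  case 0
  then show ?case by (simp add: assms[symmetric] coeff_diff coeff_scaleC coeff_M)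
next
  case (Suc n)
  have "coeff g (Suc n) = coeff f (Suc n) + of_real a * coeff g n"
    by (simp add: assms[symmetric] coeff_diff coeff_scaleC coeff_M)
  also have "\<dots> = (\<Sum>k\<le>Suc n. of_real a ^ (Suc n - k) * coeff f k)"
    by (simp add: Suc.IH sum_distrib_left Suc_diff_le mult_ac)
  finally show ?case .
qed

text \<open>
  The point \<open>1 / a\<close> lies outside the closed disc and hence outside the spectrum. As \<open>a\<close> is real, the
  factor \<open>1 / a\<close> passes through the real-linear \<open>M\<close>.
\<close>

lemma surj_one_minus_M:
  assumes "spectrum M \<subseteq> cball 0 1" "0 < a" "a < 1"
  obtains g where "g - complex_of_real a *\<^sub>C M g = f"
proof
  let ?z = "complex_of_real (1 / a)" and ?g = "(1 / a) *\<^sub>R resolvent M (complex_of_real (1 / a)) f"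
  have "?z \<notin> spectrum M" using assms by (auto simp: norm_divide)
  from resolvent_right_inverse[OF this, of f]
  have "?g - M (resolvent M ?z f) = f"
    by (simp only: scaleC_of_real)
  then show "?g - complex_of_real a *\<^sub>C M ?g = f"
    using \<open>0 < a\<close> by (simp only: scaleC_of_real blinfun.scaleR_right) simp
qed

end

section \<open>Comparing a block of coefficients with a partial sum\<close>

text \<open>
  The reciprocal of \<open>N / (N + 1)\<close> is \<open>1 + 1 / N\<close>, whose \<open>N\<close>-th power stays below \<open>exp 1 \<le> 3\<close>.
\<close>

lemma power_ge_one_ninth:
  assumes "1 \<le> N" "n \<le> 2 * N"
  shows "1 / 9 \<le> (real N / (real N + 1)) ^ n"
proof -
  have "(1 + 1 / real N) ^ N \<le> exp (1 / real N) ^ N"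
    by (intro power_mono exp_ge_add_one_self) auto
  also have "\<dots> = exp 1"
    using assms by (simp flip: exp_of_nat_mult)
  also have "exp 1 \<le> (3::real)"
    by (rule exp_le)
  finally have "((1 + 1 / real N) ^ N)\<^sup>2 \<le> 3\<^sup>2"
    by (intro power_mono) auto
  then have "(1 + 1 / real N) ^ (2 * N) \<le> 9"
    by (simp add: power_mult[symmetric] mult.commute)
  moreover have "(1 + 1 / real N) ^ n \<le> (1 + 1 / real N) ^ (2 * N)"
    using assms by (intro power_increasing) auto
  ultimately have le: "(1 + 1 / real N) ^ n \<le> 9" by linarith
  have "real N / (real N + 1) = inverse (1 + 1 / real N)"
    using assms by (simp add: field_simps)
  moreover have "inverse 9 \<le> inverse ((1 + 1 / real N) ^ n)"
    by (intro le_imp_inverse_le[OF le] zero_less_power) (simp add: add_pos_nonneg)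
  ultimately show ?thesis by (simp add: power_inverse)
qed

context diagonal_kernel_space
begin

text \<open>
  Put \<open>a = N / (N + 1)\<close> and let \<open>g = (1 - a M)\<inverse> f\<close> for the section \<open>f = \<Sum> b n z\<^sup>n\<close> over \<open>n < N\<close>.
  With \<open>s\<close> the partial sum, \<open>\<parallel>f\<parallel>\<^sup>2 = s\<close>, and the resolvent condition gives \<open>\<parallel>g\<parallel> \<le> 2 N C \<surd>s\<close>. On
  the other hand each coefficient of \<open>g\<close> with index in \<open>{N..<2*N}\<close> is at least \<open>s / 9\<close>, because the
  powers of \<open>a\<close> involved are bounded below. The sum of these \<open>N\<close> coefficients is the inner product
  of \<open>g\<close> with the section \<open>p\<close> over the block, and \<open>\<parallel>p\<parallel>\<^sup>2\<close> is the block sum \<open>t\<close>. So the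
  Cauchy--Schwarz inequality yields \<open>N s / 9 \<le> 2 N C \<surd>s \<surd>t\<close>; the factor \<open>N\<close> cancels.
\<close>

lemma block_sum_ge_partial_sum:
  assumes "moebius_bounded M"
  obtains D where "0 < D" and "\<And>N. 1 \<le> N \<Longrightarrow> (\<Sum>n<N. b n) \<le> D * (\<Sum>n=N..<2*N. b n)"
proof -
  have spec: "spectrum M \<subseteq> cball 0 1" using assms by (simp add: moebius_bounded_def)
  obtain C where "0 < C" and
    C: "\<And>a g. 0 < a \<Longrightarrow> a < 1 \<Longrightarrow> (1 - a) * norm g \<le> C * norm (g - complex_of_real a *\<^sub>C M g)"
    using moebius_bounded_imp_Kreiss[OF assms] by blast
  have "(\<Sum>n<N. b n) \<le> (18 * C)\<^sup>2 * (\<Sum>n=N..<2*N. b n)" if N: "1 \<le> N" for N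
  proof -
    define a where "a = real N / (real N + 1)"
    have a: "0 < a" "a < 1" and a1: "1 - a = 1 / (real N + 1)"
      using N by (auto simp: a_def field_simps)
    define s where "s = (\<Sum>n<N. b n)"
    define t where "t = (\<Sum>n=N..<2*N. b n)"
    define p where "p = kernel_section {N..<2*N}"
    define f where "f = kernel_section {..<N}"
    have f: "(norm f)\<^sup>2 = s" and p: "(norm p)\<^sup>2 = t"
      by (simp_all add: f_def p_def s_def t_def norm_kernel_section)
    have "0 < s"
      unfolding s_def using N b_pos by (intro sum_pos) (auto simp: lessThan_empty_iff)
    obtain g where g: "g - complex_of_real a *\<^sub>C M g = f"
      using surj_one_minus_M[OF spec a] by blast
    have coeff_g: "coeff g n = of_real (\<Sum>k<N. a ^ (n - k) * b k)" if "N \<le> n" for n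
    proof -
      have "coeff g n = (\<Sum>k\<le>n. of_real (if k < N then a ^ (n - k) * b k else 0))"
        unfolding coeff_solution[OF g] f_def
        by (intro sum.cong) (auto simp: coeff_kernel_section)
      also have "\<dots> = of_real (\<Sum>k\<in>{..n} \<inter> {..<N}. a ^ (n - k) * b k)"
        by (simp add: sum.inter_restrict)
      also have "{..n} \<inter> {..<N} = {..<N}" using that by auto
      finally show ?thesis .
    qed
    have lower: "s / 9 \<le> (\<Sum>k<N. a ^ (n - k) * b k)" if "n < 2 * N" for n
      unfolding s_def sum_divide_distrib
    proof (rule sum_mono)
      fix k
      have "1 / 9 * b k \<le> a ^ (n - k) * b k"
        unfolding a_def using that N less_imp_le[OF b_pos]
        by (intro mult_right_mono power_ge_one_ninth) auto
      then show "b k / 9 \<le> a ^ (n - k) * b k" by simp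
    qed
    have "real N * (s / 9) = (\<Sum>n=N..<2*N. s / 9)" by simp
    also have "\<dots> \<le> (\<Sum>n=N..<2*N. \<Sum>k<N. a ^ (n - k) * b k)"
      by (intro sum_mono lower) simp
    also have "\<dots> = Re (cinner g p)"
      unfolding p_def cinner_kernel_section by (simp add: coeff_g)
    also have "\<dots> \<le> norm g * norm p"
      using complex_Re_le_cmod norm_cinner_le by (rule order_trans)
    also have "norm g \<le> 2 * real N * C * norm f"
    proof -
      have "norm g \<le> (real N + 1) * (C * norm f)"
        using C[OF a, of g] by (simp add: g a1 field_simps)
      also have "\<dots> \<le> (2 * real N) * (C * norm f)"
        using N \<open>0 < C\<close> by (intro mult_right_mono) auto
      finally show ?thesis by simp
    qed
    finally have "real N * (s / 9) \<le> 2 * real N * C * norm f * norm p"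
      by (simp add: mult_right_mono)
    then have "s \<le> 18 * C * norm f * norm p"
      using N by simp
    then have "s\<^sup>2 \<le> (18 * C * norm f * norm p)\<^sup>2"
      using \<open>0 < s\<close> by (intro power_mono) auto
    also have "\<dots> = s * ((18 * C)\<^sup>2 * t)"
      by (simp only: power_mult_distrib f p mult_ac)
    finally show ?thesis
      using \<open>0 < s\<close> by (simp add: s_def[symmetric] t_def[symmetric] power2_eq_square)
  qed
  then show ?thesis
    using \<open>0 < C\<close> by (intro that[of "(18 * C)\<^sup>2"]) auto
qed

end

section \<open>Consequences for the sequence\<close>

text \<open>
  Each doubling of the number of terms adds at least \<open>c\<close> to the partial sum.
\<close>

lemma filterlim_partial_sums_if_blocks_large:
  fixes b :: "nat \<Rightarrow> real"
  assumes "\<And>n. 0 \<le> b n" and "0 < c" and block: "\<And>N. 1 \<le> N \<Longrightarrow> c \<le> (\<Sum>n=N..<2*N. b n)"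
  shows "filterlim (\<lambda>N. \<Sum>n<N. b n) at_top sequentially"
proof -
  let ?S = "\<lambda>N. \<Sum>n<N. b n"
  have "mono ?S" using assms(1) by (auto intro!: monoI sum_mono2)
  have S2: "?S (2 * N) = ?S N + (\<Sum>n=N..<2*N. b n)" for N
    using sum.atLeastLessThan_concat[of 0 N "2 * N" b] by (simp add: atLeast0LessThan)
  have pow: "real k * c \<le> ?S (2 ^ k)" for k
  proof (induction k)
    case 0
    then show ?case using assms(1) by (simp add: sum_nonneg)
  next
    case (Suc k)
    then show ?case using block[of "2 ^ k"] S2[of "2 ^ k"] by (simp add: algebra_simps)
  qed
  show ?thesis
    unfolding filterlim_at_top eventually_sequentially
  proof
    fix Z :: real
    obtain k where "Z / c \<le> real k" using real_arch_simple by blast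
    then have "Z \<le> ?S (2 ^ k)" using pow[of k] \<open>0 < c\<close> by (simp add: field_simps)
    then show "\<exists>N. \<forall>n\<ge>N. Z \<le> ?S n"
      using monoD[OF \<open>mono ?S\<close>] by (meson order_trans)
  qed
qed

lemma block_sum_le_if_bounded:
  fixes b :: "nat \<Rightarrow> real"
  assumes "\<And>n. real n * b n \<le> B" and "1 \<le> N"
  shows "(\<Sum>n=N..<2*N. b n) \<le> \<bar>B\<bar>"
proof -
  have "(\<Sum>n=N..<2*N. b n) \<le> (\<Sum>n=N..<2*N. \<bar>B\<bar> / real N)"
  proof (rule sum_mono)
    fix n assume n: "n \<in> {N..<2*N}"
    with assms(2) have "0 < real n" by auto
    then have "b n \<le> B / real n"
      using assms(1)[of n] by (simp add: field_simps)
    also have "\<dots> \<le> \<bar>B\<bar> / real N"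
      using n assms(2) by (intro frac_le) auto
    finally show "b n \<le> \<bar>B\<bar> / real N" .
  qed
  then show ?thesis using assms(2) by simp
qed

theorem theorem4p4:
  fixes b :: "nat \<Rightarrow> real"
    and K :: "complex \<Rightarrow> complex \<Rightarrow> complex"
    and ev :: "'h::complex_hilbert \<Rightarrow> complex \<Rightarrow> complex"
    and M :: "'h \<Rightarrow>\<^sub>L 'h"
  assumes "\<And>n. b n > 0"
    and "\<And>z w. z \<in> ball 0 1 \<Longrightarrow> w \<in> ball 0 1 \<Longrightarrow>
           (\<lambda>n. of_real (b n) * (z * cnj w) ^ n) sums K z w"
    and "positive_definite_kernel (ball 0 1) K"
    and "reproducing_kernel_hilbert_space (ball 0 1) K ev"
    and "\<And>f. ev f holomorphic_on ball 0 1"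
    and "multiplication_by_z (ball 0 1) ev M"
    and "moebius_bounded M"
  shows "filterlim (\<lambda>N. \<Sum>n<N. b n) at_top sequentially \<and>
         \<not> bounded (range (\<lambda>n. real n * b n))"
proof
  interpret diagonal_kernel_space b K ev M
    by unfold_locales (use assms in auto)
  obtain D where "0 < D" and D: "\<And>N. 1 \<le> N \<Longrightarrow> (\<Sum>n<N. b n) \<le> D * (\<Sum>n=N..<2*N. b n)"
    using block_sum_ge_partial_sum[OF assms(7)] by blast
  show divergent: "filterlim (\<lambda>N. \<Sum>n<N. b n) at_top sequentially"
  proof (rule filterlim_partial_sums_if_blocks_large)
    show "0 < b 0 / D" using \<open>0 < D\<close> b_pos by simp
    fix N :: nat assume N: "1 \<le> N"
    have "(\<Sum>n\<in>{0}. b n) \<le> (\<Sum>n<N. b n)"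
      using N less_imp_le[OF b_pos] by (intro sum_mono2) auto
    with D[OF N] have "b 0 \<le> D * (\<Sum>n=N..<2*N. b n)" by simp
    then show "b 0 / D \<le> (\<Sum>n=N..<2*N. b n)"
      using \<open>0 < D\<close> by (simp add: field_simps)
  qed (rule less_imp_le[OF b_pos])
  show "\<not> bounded (range (\<lambda>n. real n * b n))"
  proof
    assume "bounded (range (\<lambda>n. real n * b n))"
    then obtain B where B: "\<And>n. \<bar>real n * b n\<bar> \<le> B"
      by (auto simp: bounded_iff)
    have le: "(\<Sum>n<N. b n) \<le> D * \<bar>B\<bar>" if "1 \<le> N" for N
    proof -
      have "(\<Sum>n=N..<2*N. b n) \<le> \<bar>B\<bar>"
        using B that by (intro block_sum_le_if_bounded) (auto intro: order_trans[OF abs_ge_self])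
      then show ?thesis
        using D[OF that] \<open>0 < D\<close> by (meson mult_left_mono less_imp_le order_trans)
    qed
    have "eventually (\<lambda>N. D * \<bar>B\<bar> < (\<Sum>n<N. b n)) sequentially"
      using divergent by (simp add: filterlim_at_top_dense)
    then obtain N where "\<And>m. N \<le> m \<Longrightarrow> D * \<bar>B\<bar> < (\<Sum>n<m. b n)"
      by (auto simp: eventually_sequentially)
    from this[of "Suc N"] le[of "Suc N"] show False by simp
  qed
qed

end
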